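(* Let $G$ be a connected bipartite graph with a unique perfect matching $\mathcal{M}$ such that every cycle of $G$ contains an even number of edges not in $\mathcal{M}$. Then for every $u\in V(G)$, $D_uA(G)D_u=H_{-1}(X_G)$.
   Context: $A(G)$ is the adjacency matrix of $G$. $X_G$ is the mixed graph obtained from $G$ by orienting all edges not in $\mathcal{M}$ (matching edges stay undirected); its $(-1)$-hermitian adjacency matrix $H_{-1}(X_G)=[h_{xy}]$ has $h_{xy}=1$ if $xy\in\mathcal{M}$, $h_{xy}=-1$ if $xy$ is an edge of $G$ not in $\mathcal{M}$ (arc in either direction, since $\overline{-1}=-1$), and $h_{xy}=0$ otherwise. For a fixed $u\in V(G)$ and any $v\in V(G)$, define $w(v)=(-1)^{t}$ where $t$ is the number of edges not in $\mathcal{M}$ on a path from $u$ to $v$ (under the hypothesis on cycles this does not depend on the chosen path; $w(u)=1$). With $V(G)=\{v_1,\dots,v_n\}$, $D_u=\mathrm{diag}\{w(v_1),\dots,w(v_n)\}$. *)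

theory Defs
  imports "Jordan_Normal_Form.Matrix" "HOL-Library.Disjoint_Sets" Complex_Main
begin

record 'a ugraph =
  verts :: "'a set"
  edges :: "'a set set"

definition simple_graph :: "'a ugraph \<Rightarrow> bool" where
  "simple_graph G \<longleftrightarrow> finite (verts G) \<and>
     (\<forall>e\<in>edges G. \<exists>x\<in>verts G. \<exists>y\<in>verts G. x \<noteq> y \<and> e = {x, y})"

text \<open>Walks are non-empty vertex lists; a single vertex is the walk (and path) of length 0.\<close>

definition is_walk :: "'a ugraph \<Rightarrow> 'a list \<Rightarrow> bool" where
  "is_walk G p \<longleftrightarrow> p \<noteq> [] \<and> set p \<subseteq> verts G \<and> successively (\<lambda>x y. {x, y} \<in> edges G) p"

definition is_path :: "'a ugraph \<Rightarrow> 'a \<Rightarrow> 'a list \<Rightarrow> 'a \<Rightarrow> bool" where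
  "is_path G x p y \<longleftrightarrow> is_walk G p \<and> distinct p \<and> hd p = x \<and> last p = y"

definition walk_edges :: "'a list \<Rightarrow> 'a set set" where
  "walk_edges p = (\<lambda>(x, y). {x, y}) ` set (zip p (tl p))"

text \<open>A cycle is given by the list of its vertices without repeating the first one at the end;
  the closing edge joins the last vertex to the first.\<close>

definition is_cycle :: "'a ugraph \<Rightarrow> 'a list \<Rightarrow> bool" where
  "is_cycle G c \<longleftrightarrow> length c \<ge> 3 \<and> distinct c \<and> is_walk G (c @ [hd c])"

definition cycle_edges :: "'a list \<Rightarrow> 'a set set" where
  "cycle_edges c = walk_edges (c @ [hd c])"

definition connected_graph :: "'a ugraph \<Rightarrow> bool" where
  "connected_graph G \<longleftrightarrow> verts G \<noteq> {} \<and>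
     (\<forall>x\<in>verts G. \<forall>y\<in>verts G. \<exists>p. is_path G x p y)"

definition bipartite_graph :: "'a ugraph \<Rightarrow> bool" where
  "bipartite_graph G \<longleftrightarrow> (\<exists>X Y. X \<inter> Y = {} \<and> X \<union> Y = verts G \<and>
     (\<forall>e\<in>edges G. \<exists>x\<in>X. \<exists>y\<in>Y. e = {x, y}))"

definition perfect_matching :: "'a ugraph \<Rightarrow> 'a set set \<Rightarrow> bool" where
  "perfect_matching G M \<longleftrightarrow> M \<subseteq> edges G \<and> disjoint M \<and> \<Union>M = verts G"

definition unique_perfect_matching :: "'a ugraph \<Rightarrow> 'a set set \<Rightarrow> bool" where
  "unique_perfect_matching G M \<longleftrightarrow>
     perfect_matching G M \<and> (\<forall>N. perfect_matching G N \<longrightarrow> N = M)"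

text \<open>Matrices are indexed by an enumeration \<open>vs\<close> of the vertices.\<close>

definition adj_matrix :: "'a ugraph \<Rightarrow> 'a list \<Rightarrow> complex mat" where
  "adj_matrix G vs = mat (length vs) (length vs)
     (\<lambda>(i, j). if {vs ! i, vs ! j} \<in> edges G then 1 else 0)"

record 'a mixed_graph =
  mverts :: "'a set"
  medges :: "'a set set"
  marcs :: "('a \<times> 'a) set"

text \<open>The mixed graph \<open>X\<close> arises from \<open>G\<close> by giving each edge outside \<open>M\<close> exactly one of its
  two directions, chosen arbitrarily, and leaving the edges in \<open>M\<close> undirected.\<close>

definition orients_unmatched :: "'a ugraph \<Rightarrow> 'a set set \<Rightarrow> 'a mixed_graph \<Rightarrow> bool" where
  "orients_unmatched G M X \<longleftrightarrow> mverts X = verts G \<and> medges X = M \<and>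
     (\<forall>(x, y)\<in>marcs X. {x, y} \<in> edges G - M) \<and>
     (\<forall>x y. {x, y} \<in> edges G - M \<longrightarrow> ((x, y) \<in> marcs X \<longleftrightarrow> (y, x) \<notin> marcs X))"

text \<open>The \<open>\<alpha>\<close>-hermitian adjacency matrix, intended for \<open>\<alpha>\<close> of modulus 1.\<close>

definition herm_adj_matrix :: "complex \<Rightarrow> 'a mixed_graph \<Rightarrow> 'a list \<Rightarrow> complex mat" where
  "herm_adj_matrix \<alpha> X vs = mat (length vs) (length vs)
     (\<lambda>(i, j). if {vs ! i, vs ! j} \<in> medges X then 1
               else if (vs ! i, vs ! j) \<in> marcs X then \<alpha>
               else if (vs ! j, vs ! i) \<in> marcs X then cnj \<alpha>
               else 0)"

text \<open>The description is proper only if all paths from \<open>u\<close> to \<open>v\<close> give the same sign.\<close>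

definition path_sign :: "'a ugraph \<Rightarrow> 'a set set \<Rightarrow> 'a \<Rightarrow> 'a \<Rightarrow> complex" where
  "path_sign G M u v =
     (THE s. \<exists>p. is_path G u p v \<and> s = (- 1) ^ card (walk_edges p - M))"

definition sign_matrix :: "'a ugraph \<Rightarrow> 'a set set \<Rightarrow> 'a \<Rightarrow> 'a list \<Rightarrow> complex mat" where
  "sign_matrix G M u vs = mat_diag (length vs) (\<lambda>i. path_sign G M u (vs ! i))"

end

theory Submission
  imports Defs
begin

text \<open>The sign of a walk is the product of the signs of its steps. A closed walk which is neither
  a cycle nor a single edge traversed back and forth revisits a vertex and can be cut there into
  two shorter closed walks, so by the hypothesis on cycles every closed walk has sign \<open>1\<close>. Closing
  up two paths from \<open>u\<close> to \<open>v\<close> shows that \<open>w(v)\<close> is well defined; closing up a path to \<open>x\<close> and a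
  path to \<open>y\<close> by an edge \<open>xy\<close> shows that \<open>w(x) w(y)\<close> is the sign of that edge.\<close>

fun walk_sign :: "'a set set \<Rightarrow> 'a list \<Rightarrow> complex" where
  "walk_sign M (x # y # zs) = (if {x, y} \<in> M then 1 else - 1) * walk_sign M (y # zs)"
| "walk_sign M _ = 1"

text \<open>The cut vertex \<open>y\<close> belongs to both pieces, so each step of the walk lies in
  exactly one factor.\<close>

lemma walk_sign_split:
  "walk_sign M (xs @ y # zs) = walk_sign M (xs @ [y]) * walk_sign M (y # zs)"
proof (induction xs)
  case (Cons x xs)
  then show ?case by (cases xs) auto
qed auto

lemma walk_sign_rev: "walk_sign M (rev p) = walk_sign M p"
proof (induction M p rule: walk_sign.induct)
  case (1 M x y zs)
  have "walk_sign M (rev (x # y # zs)) = walk_sign M (rev zs @ [y]) * walk_sign M [y, x]"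
    using walk_sign_split[of M "rev zs" y "[x]"] by simp
  with 1 show ?case by (simp add: insert_commute)
qed auto

lemma walk_sign_square: "walk_sign M p * walk_sign M p = 1"
  by (induction M p rule: walk_sign.induct) auto

lemma walk_edges_Cons: "walk_edges (x # y # zs) = insert {x, y} (walk_edges (y # zs))"
  by (simp add: walk_edges_def)

lemma walk_edges_subset: "e \<in> walk_edges p \<Longrightarrow> e \<subseteq> set p"
  unfolding walk_edges_def by (cases p) (auto dest: set_zip_leftD set_zip_rightD)

lemma finite_walk_edges: "finite (walk_edges p)"
  by (simp add: walk_edges_def)

lemma sign_card_insert:
  assumes "finite A" "e \<notin> A"
  shows "(- 1 :: complex) ^ card (insert e A - M)
    = (if e \<in> M then 1 else - 1) * (- 1) ^ card (A - M)"
  using assms by (simp add: insert_Diff_if)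

text \<open>\<open>walk_sign\<close> counts steps with multiplicity, while \<open>walk_edges\<close>
  is a set. The two counts agree here because a walk without repeated vertices uses no edge
  twice.\<close>

lemma walk_sign_distinct:
  "distinct p \<Longrightarrow> walk_sign M p = (- 1) ^ card (walk_edges p - M)"
proof (induction M p rule: walk_sign.induct)
  case (1 M x y zs)
  have "{x, y} \<notin> walk_edges (y # zs)"
    using 1(2) by (auto dest: walk_edges_subset)
  with 1 show ?case
    by (simp add: walk_edges_Cons sign_card_insert finite_walk_edges)
qed (auto simp: walk_edges_def)

text \<open>The list minus its first step is a rotation of \<open>c\<close>, hence distinct. The
  first edge \<open>{x, y}\<close> does not recur there: only \<open>{y, z}\<close> contains
  \<open>y\<close>, and \<open>x\<close> differs from \<open>z\<close>. With two vertices the same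
  edge would be traversed twice.\<close>

lemma walk_sign_cycle:
  assumes "distinct c" "length c \<ge> 3"
  shows "walk_sign M (c @ [hd c]) = (- 1) ^ card (cycle_edges c - M)"
proof -
  obtain x y z zs where c: "c = x # y # z # zs"
    using assms(2) by (auto simp: numeral_3_eq_3 Suc_le_length_iff)
  let ?p = "y # z # zs @ [x]"
  have "{x, y} \<notin> walk_edges (z # zs @ [x])" "{x, y} \<noteq> {y, z}"
    using assms(1) c by (auto dest: walk_edges_subset simp: doubleton_eq_iff)
  hence "{x, y} \<notin> walk_edges ?p"
    by (simp add: walk_edges_Cons)
  moreover have "walk_sign M ?p = (- 1) ^ card (walk_edges ?p - M)"
    by (rule walk_sign_distinct) (use assms(1) c in auto)
  moreover have "cycle_edges c = insert {x, y} (walk_edges ?p)"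
    by (simp add: cycle_edges_def c walk_edges_Cons)
  ultimately show ?thesis
    by (simp add: c sign_card_insert finite_walk_edges)
qed

lemma is_walk_append:
  "is_walk G (xs @ y # zs) \<longleftrightarrow> is_walk G (xs @ [y]) \<and> is_walk G (y # zs)"
  by (auto simp: is_walk_def successively_append_iff)

lemma is_walk_rev: "is_walk G (rev p) \<longleftrightarrow> is_walk G p"
  by (simp add: is_walk_def insert_commute)

text \<open>Induction on the number of inner vertices. The base point \<open>x\<close> stays
  arbitrary because a piece that is cut out starts at another vertex in general.\<close>

lemma closed_walk_sign_snoc:
  assumes "simple_graph G"
    and cyc: "\<And>c. is_cycle G c \<Longrightarrow> even (card (cycle_edges c - M))"
    and "is_walk G (x # p @ [x])"
  shows "walk_sign M (x # p @ [x]) = 1"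
  using assms(3)
proof (induction p arbitrary: x rule: length_induct)
  case (1 p)
  show ?case
  proof (cases "distinct (x # p)")
    case True
    consider "p = []" | y where "p = [y]" | "length p \<ge> 2"
      by (cases p rule: remdups_adj.cases) auto
    then show ?thesis
    proof cases
      case 1
      \<comment> \<open>The walk would be a loop at \<open>x\<close>, which a simple graph
        excludes.\<close>
      with "1.prems" have "{x} \<in> edges G" by (simp add: is_walk_def)
      with assms(1) show ?thesis by (fastforce simp: simple_graph_def)
    next
      case 2
      then show ?thesis by (simp add: insert_commute)
    next
      case 3
      with True "1.prems" have "is_cycle G (x # p)" by (simp add: is_cycle_def)
      with cyc walk_sign_cycle[OF True, of M] 3 show ?thesis by simp
    qed
  next
    case False
    then obtain xs y ys zs where d: "x # p = xs @ [y] @ ys @ [y] @ zs"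
      using not_distinct_decomp by blast
    \<comment> \<open>\<open>p'\<close> holds the inner vertices left after removing the closed
      detour from \<open>y\<close> to \<open>y\<close>. If \<open>xs\<close> is empty, then
      \<open>y = x\<close> and \<open>p' = zs\<close>.\<close>
    obtain p' where p': "x # p' = xs @ y # zs"
      using d by (cases xs) auto
    have len: "length ys < length p" "length p' < length p"
      using arg_cong[OF d, of length] arg_cong[OF p', of length] by auto
    have eq: "x # p @ [x] = xs @ y # ys @ y # zs @ [x]" "x # p' @ [x] = xs @ y # zs @ [x]"
      using arg_cong[OF d, of "\<lambda>l. l @ [x]"] arg_cong[OF p', of "\<lambda>l. l @ [x]"] by simp_all
    have w: "is_walk G (xs @ [y])" "is_walk G (y # ys @ [y])" "is_walk G (y # zs @ [x])"
      using "1.prems" unfolding eq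
      using is_walk_append[of G xs y "ys @ y # zs @ [x]"]
        is_walk_append[of G "y # ys" y "zs @ [x]"] by auto
    have "walk_sign M (x # p @ [x])
        = walk_sign M (xs @ [y]) * (walk_sign M (y # ys @ [y]) * walk_sign M (y # zs @ [x]))"
      unfolding eq using walk_sign_split[of M xs y "ys @ y # zs @ [x]"]
        walk_sign_split[of M "y # ys" y "zs @ [x]"] by simp
    also have "walk_sign M (y # ys @ [y]) = 1"
      using "1.IH" len w by blast
    also have "walk_sign M (xs @ [y]) * (1 * walk_sign M (y # zs @ [x]))
        = walk_sign M (x # p' @ [x])"
      unfolding eq using walk_sign_split[of M xs y "zs @ [x]"] by simp
    also have "\<dots> = 1"
    proof -
      have "is_walk G (x # p' @ [x])"
        unfolding eq using w is_walk_append[of G xs y "zs @ [x]"] by simp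
      with "1.IH" len show ?thesis by blast
    qed
    finally show ?thesis .
  qed
qed

lemma closed_walk_sign:
  assumes "simple_graph G"
    and "\<And>c. is_cycle G c \<Longrightarrow> even (card (cycle_edges c - M))"
    and "is_walk G p" "hd p = last p"
  shows "walk_sign M p = 1"
proof (cases p)
  case (Cons x xs)
  then show ?thesis
    using assms(3,4) closed_walk_sign_snoc[OF assms(1,2)] by (cases xs rule: rev_cases) auto
qed simp

text \<open>Following \<open>p\<close>, the edge \<open>xy\<close> and then \<open>q\<close>
  backwards gives a closed walk at \<open>u\<close>, of sign 1. The sign of the edge is its own
  inverse, so it may change sides.\<close>

lemma walk_signs_edge:
  assumes "simple_graph G"
    and "\<And>c. is_cycle G c \<Longrightarrow> even (card (cycle_edges c - M))"
    and p: "is_path G u p x" and q: "is_path G u q y" and e: "{x, y} \<in> edges G"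
  shows "walk_sign M p * walk_sign M q = (if {x, y} \<in> M then 1 else - 1)"
proof -
  obtain p' where p': "p = p' @ [x]"
    using p by (metis append_butlast_last_id is_path_def is_walk_def)
  obtain q' where q': "rev q = y # q'"
    using q by (metis hd_Cons_tl hd_rev is_path_def is_walk_def rev_is_Nil_conv)
  have "is_walk G (y # q')"
    using q q' by (metis is_path_def is_walk_rev)
  hence w: "is_walk G (p @ rev q)"
    using p e is_walk_append[of G p' x "y # q'"] unfolding p' q'
    by (auto simp: is_path_def is_walk_def)
  have ends: "hd (p @ rev q) = last (p @ rev q)"
    using p q by (auto simp: is_path_def is_walk_def last_rev)
  have "walk_sign M p * ((if {x, y} \<in> M then 1 else - 1) * walk_sign M q) = walk_sign M (p @ rev q)"
    using walk_sign_split[of M p' x "y # q'"] walk_sign_rev[of M q] by (simp add: p' q')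
  also have "\<dots> = 1"
    by (rule closed_walk_sign[OF assms(1,2) w ends])
  finally show ?thesis
    by (auto split: if_splits simp: minus_equation_iff)
qed

text \<open>Following \<open>p\<close> and returning along \<open>q\<close> gives a closed walk of
  sign 1. Both paths end in \<open>v\<close>, which is listed only once in the joined walk.\<close>

lemma walk_sign_unique:
  assumes "simple_graph G"
    and "\<And>c. is_cycle G c \<Longrightarrow> even (card (cycle_edges c - M))"
    and p: "is_path G u p v" and q: "is_path G u q v"
  shows "walk_sign M p = walk_sign M q"
proof -
  obtain p' where p': "p = p' @ [v]"
    using p by (metis append_butlast_last_id is_path_def is_walk_def)
  obtain q' where q': "rev q = v # q'"
    using q by (metis hd_Cons_tl hd_rev is_path_def is_walk_def rev_is_Nil_conv)
  have "is_walk G (v # q')"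
    using q q' by (metis is_path_def is_walk_rev)
  hence w: "is_walk G (p' @ v # q')"
    using p is_walk_append[of G p' v q'] unfolding p' by (auto simp: is_path_def)
  have "hd (p' @ v # q') = hd p" "last (p' @ v # q') = last (rev q)"
    unfolding p' q' by (cases p'; simp)+
  hence ends: "hd (p' @ v # q') = last (p' @ v # q')"
    using p q by (simp add: is_path_def is_walk_def last_rev)
  have "walk_sign M p * walk_sign M q = walk_sign M (p' @ v # q')"
    using walk_sign_split[of M p' v q'] walk_sign_rev[of M q] by (simp add: p' q')
  also have "\<dots> = 1"
    by (rule closed_walk_sign[OF assms(1,2) w ends])
  \<comment> \<open>Writing 1 as the square of the sign of \<open>q\<close> allows this nonzero
    factor to be cancelled.\<close>
  finally have "walk_sign M p * walk_sign M q = walk_sign M q * walk_sign M q"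
    by (simp add: walk_sign_square)
  moreover have "walk_sign M q \<noteq> 0"
    using walk_sign_square[of M q] by auto
  ultimately show ?thesis by simp
qed

text \<open>All paths from \<open>u\<close> to \<open>v\<close> give one sign, so the definite
  description is proper and any path may be used to evaluate it.\<close>

lemma path_sign_eq_walk_sign:
  assumes "simple_graph G"
    and "\<And>c. is_cycle G c \<Longrightarrow> even (card (cycle_edges c - M))"
    and "is_path G u p v"
  shows "path_sign G M u v = walk_sign M p"
proof -
  have sign: "(- 1) ^ card (walk_edges q - M) = walk_sign M p" if "is_path G u q v" for q
    using walk_sign_unique[OF assms(1,2) that assms(3)] walk_sign_distinct[of q M] that
    by (simp add: is_path_def)
  show ?thesis
    unfolding path_sign_def
    by (rule the_equality) (use assms(3) sign in \<open>auto intro: exI[of _ p]\<close>)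
qed

theorem theorem9:
  fixes G :: "'a ugraph" and M :: "'a set set" and X :: "'a mixed_graph"
    and u :: 'a and vs :: "'a list"
  assumes "simple_graph G"
    and "connected_graph G"
    and "bipartite_graph G"
    and "unique_perfect_matching G M"
    and "\<And>c. is_cycle G c \<Longrightarrow> even (card (cycle_edges c - M))"
    and "orients_unmatched G M X"
    and "distinct vs" and "set vs = verts G"
    and "u \<in> verts G"
  shows "sign_matrix G M u vs * adj_matrix G vs * sign_matrix G M u vs
           = herm_adj_matrix (- 1) X vs"
proof -
  let ?n = "length vs" and ?w = "path_sign G M u"
  let ?a = "\<lambda>x y. if {x, y} \<in> edges G then 1 else 0 :: complex"
  let ?h = "\<lambda>x y. if {x, y} \<in> medges X then 1 else if (x, y) \<in> marcs X then - 1
    else if (y, x) \<in> marcs X then cnj (- 1) else 0 :: complex"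
  have M: "M \<subseteq> edges G"
    using assms(4) by (auto simp: unique_perfect_matching_def perfect_matching_def)
  have entry: "?w x * ?a x y * ?w y = ?h x y" if xy: "x \<in> verts G" "y \<in> verts G" for x y
  proof (cases "{x, y} \<in> edges G")
    case True
    obtain p q where p: "is_path G u p x" and q: "is_path G u q y"
      using assms(2,9) xy unfolding connected_graph_def by blast
    have "?w x * ?w y = (if {x, y} \<in> M then 1 else - 1)"
      using path_sign_eq_walk_sign[OF assms(1,5) p] path_sign_eq_walk_sign[OF assms(1,5) q]
        walk_signs_edge[OF assms(1,5) p q True] by simp
    \<comment> \<open>An unmatched edge carries an arc in one of its directions; which one is
      irrelevant, since -1 is its own conjugate.\<close>
    moreover have "?h x y = (if {x, y} \<in> M then 1 else - 1)"
      using True assms(6) unfolding orients_unmatched_def by auto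
    ultimately show ?thesis using True by simp
  next
    case False
    hence False': "{y, x} \<notin> edges G"
      by (simp add: insert_commute)
    have "{x, y} \<notin> medges X"
      using M False assms(6) unfolding orients_unmatched_def by blast
    moreover have "(x, y) \<notin> marcs X"
      using False assms(6) unfolding orients_unmatched_def by blast
    moreover have "(y, x) \<notin> marcs X"
      using False' assms(6) unfolding orients_unmatched_def by blast
    ultimately show ?thesis using False by simp
  qed
  have A: "adj_matrix G vs \<in> carrier_mat ?n ?n"
    by (simp add: adj_matrix_def)
  \<comment> \<open>Diagonal factors on the left and right scale the rows and columns, so the claim
    reduces to \<open>entry\<close>.\<close>
  have "sign_matrix G M u vs * adj_matrix G vs * sign_matrix G M u vs
      = mat ?n ?n (\<lambda>(i, j). ?w (vs ! i) * ?a (vs ! i) (vs ! j) * ?w (vs ! j))"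
    unfolding sign_matrix_def mat_diag_mult_left[OF A]
    by (subst mat_diag_mult_right[of _ ?n]) (auto simp: adj_matrix_def)
  also have "\<dots> = herm_adj_matrix (- 1) X vs"
    unfolding herm_adj_matrix_def
    by (rule cong_mat) (simp_all only: split_conv entry[folded assms(8)] nth_mem)
  finally show ?thesis .
qed

end
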